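(* Let $\rho,\kappa>-1$ be real numbers, $m\ge0$ an integer and $n$ an integer with $n+\rho\ge0$, and let $z\in\mathbb{D}^*$. For $\rho\in\{0,1,2,\dots\}$ we have $$\mathcal{Z}^{\kappa,\rho}_{m,n}(z,\bar z)=\frac{(\kappa+1)_{m\vee(n+\rho)}\,(m\wedge(n+\rho))!}{(\kappa+1)_{n+\rho}}\;\frac{z^n\bar z^m}{|z|^{2(m\wedge(n+\rho))}}\;P^{(\kappa,|m-n-\rho|)}_{m\wedge(n+\rho)}(2|z|^2-1),$$ while when $\rho>-1$ is non-integer, or $m=m\wedge(n+\rho)$, we have $$\mathcal{Z}^{\kappa,\rho}_{m,n}(z,\bar z)=m!\,z^{n-m}\,P_m^{(\kappa,\,n-m+\rho)}(2|z|^2-1).$$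
   Context: Let $\mathbb{D}=\{z\in\mathbb{C}:|z|<1\}$ and $\mathbb{D}^*=\mathbb{D}\setminus\{0\}$; $\partial/\partial z$ is the Wirtinger derivative, $(a)_n=a(a+1)\cdots(a+n-1)$, $x\wedge y=\min(x,y)$ and $x\vee y=\max(x,y)$. For reals $\rho,\kappa>-1$ and integers $m\ge0$, $n$ with $n+\rho\ge0$, the fractional Zernike function on $\mathbb{D}^*$ is $$\mathcal{Z}^{\kappa,\rho}_{m,n}(z,\bar z)=(-1)^m z^{-\rho}(1-|z|^2)^{-\kappa}\frac{\partial^m}{\partial z^m}\Big(z^{n+\rho}(1-|z|^2)^{\kappa+m}\Big),$$ the powers $z^{-\rho}$ and $z^{n+\rho}$ being taken with the same local branch (the result does not depend on the choice). For $a>-1$ and any real $b$, $P^{(a,b)}_m$ denotes the Jacobi polynomial $P^{(a,b)}_m(1-2x)=\frac{(a+1)_m}{m!}\,{}_2F_1(-m,\,m+a+b+1;\,a+1;\,x)$. *)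

theory Defs
  imports "HOL-Analysis.Analysis"
begin

(* The partial derivatives in x and y are the derivatives along the two
   coordinate directions of the real plane: d/dz = (d/dx - i d/dy) / 2. *)
definition wirtinger :: "(complex \<Rightarrow> complex) \<Rightarrow> complex \<Rightarrow> complex" where
  "wirtinger f z =
     (vector_derivative (\<lambda>x. f (z + complex_of_real x)) (at 0)
      - \<i> * vector_derivative (\<lambda>y. f (z + \<i> * complex_of_real y)) (at 0)) / 2"

definition log_branch_on :: "complex set \<Rightarrow> (complex \<Rightarrow> complex) \<Rightarrow> bool" where
  "log_branch_on U L \<longleftrightarrow> open U \<and> continuous_on U L \<and> (\<forall>w\<in>U. exp (L w) = w)"

lemma log_branch_on_exists:
  assumes "z \<noteq> 0"
  shows "\<exists>U L. z \<in> U \<and> log_branch_on U L"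
proof -
  have "w \<noteq> 0" if "w \<in> ball z (norm z)" for w
    using that by auto
  then obtain L where "continuous_on (ball z (norm z)) L"
      "\<And>w. w \<in> ball z (norm z) \<Longrightarrow> w = exp (L w)"
    using continuous_logarithm_on_ball[of z "norm z" "\<lambda>w. w"] by auto
  then show ?thesis
    using assms by (intro exI[of _ "ball z (norm z)"] exI[of _ L]) (auto simp: log_branch_on_def)
qed

(* A local branch of a complex power is fixed by a local branch L of the
   logarithm: w^s = exp (s * L w).  Only the values of L near z matter, and the
   same L is used for both powers. *)
definition zernike ::
  "(complex \<Rightarrow> complex) \<Rightarrow> real \<Rightarrow> real \<Rightarrow> nat \<Rightarrow> int \<Rightarrow> complex \<Rightarrow> complex" where
  "zernike L \<kappa> \<rho> m n z =
     (-1) ^ m * exp (complex_of_real (- \<rho>) * L z)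
     * complex_of_real ((1 - (norm z)\<^sup>2) powr (- \<kappa>))
     * (wirtinger ^^ m)
         (\<lambda>w. exp (complex_of_real (of_int n + \<rho>) * L w)
              * complex_of_real ((1 - (norm w)\<^sup>2) powr (\<kappa> + real m))) z"

(* Here y = 1 - 2x; the hypergeometric series terminates after the term of
   index m. *)
definition jacobi_P :: "nat \<Rightarrow> real \<Rightarrow> real \<Rightarrow> real \<Rightarrow> real" where
  "jacobi_P m a b y =
     pochhammer (a + 1) m / fact m
     * eval_fps (fps_hypergeo [- real m, real m + a + b + 1] [a + 1] 1) ((1 - y) / 2)"

end

theory Submission
  imports Defs
begin

text \<open>
  Write \<open>t = \<bar>z\<bar>\<^sup>2\<close>, \<open>x = 1 - t\<close> and \<open>s = n + \<rho>\<close>. For the Wirtinger derivative in \<open>z\<close> the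
  conjugate of \<open>z\<close> is a constant, so the iterated derivatives of \<open>z\<^sup>s\<close> and of
  \<open>(1 - z cnj z)\<close> to the power \<open>\<kappa> + m\<close> are again powers, with falling factorials and powers of \<open>- cnj z\<close> in front. The
  Leibniz rule then gives (\<open>zernike_gchoose_sum\<close>) the polynomial expression
  \[ m!\, z^{n-m} \sum_{k\le m} {m+\kappa \choose k}{s \choose m-k} (-x)^{m-k} t^k . \]
  This sum is a Jacobi polynomial: \<open>jacobi_P_gchoose_sum\<close> expands \<open>(1 - x)\<^sup>k\<close> in the two-term form
  of \<open>P\<^sub>m\<close> with parameters \<open>a\<close>, \<open>b\<close> and recognises each coefficient of the hypergeometric
  polynomial in \<open>x\<close> as a Vandermonde convolution. With \<open>b = s - m\<close> this is the second formula of
  the theorem.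

  When \<open>s = N\<close> is a natural number, the first formula for \<open>N \<ge> m\<close> is the second one with
  \<open>cnj z = t / z\<close> inserted. For \<open>N < m\<close> the second parameter is the negative integer \<open>N - m\<close>. The
  binomial coefficients of \<open>N\<close> then vanish for \<open>k < m - N\<close>, so that \<open>t\<close> to the power \<open>m - N\<close>
  factors out of the sum; what remains is a multiple of \<open>P\<^sub>N\<close> with parameter \<open>m - N\<close>
  (\<open>jacobi_P_negative_integer_parameter\<close>).
\<close>

section \<open>Wirtinger derivatives and the Leibniz rule\<close>

text \<open>Real differentiability is built in, because the two directional derivatives that define
  \<^const>\<open>wirtinger\<close> do not by themselves satisfy the rules of calculus. Every real-linear map of the
  plane has the form \<open>h \<mapsto> d h + e cnj h\<close>; the Wirtinger derivative is the coefficient \<open>d\<close>.\<close>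

definition has_wirtinger :: "(complex \<Rightarrow> complex) \<Rightarrow> complex \<Rightarrow> complex \<Rightarrow> bool" where
  "has_wirtinger f d z \<longleftrightarrow> (\<exists>e. (f has_derivative (\<lambda>h. d * h + e * cnj h)) (at z))"

lemma wirtinger_eqI:
  assumes "has_wirtinger f d z"
  shows "wirtinger f z = d"
proof -
  obtain e where e: "(f has_derivative (\<lambda>h. d * h + e * cnj h)) (at z)"
    using assms by (auto simp: has_wirtinger_def)
  have line: "vector_derivative (\<lambda>t. f (z + v * complex_of_real t)) (at 0) = d * v + e * cnj v" for v
  proof -
    have "((\<lambda>t. z + v * complex_of_real t) has_derivative (\<lambda>t. v * complex_of_real t)) (at 0)"
      by (auto intro!: derivative_eq_intros)
    moreover have "(f has_derivative (\<lambda>h. d * h + e * cnj h))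
        (at (z + v * complex_of_real 0))"
      using e by simp
    ultimately have "((\<lambda>t. f (z + v * complex_of_real t)) has_derivative
        (\<lambda>t. d * (v * complex_of_real t) + e * cnj (v * complex_of_real t))) (at 0)"
      by (rule has_derivative_compose)
    then have "((\<lambda>t. f (z + v * complex_of_real t)) has_vector_derivative d * v + e * cnj v) (at 0)"
      by (simp add: has_vector_derivative_def scaleR_conv_of_real algebra_simps)
    then show ?thesis
      by (rule vector_derivative_at)
  qed
  show ?thesis
    unfolding wirtinger_def line[of \<i>] line[of 1, simplified] by (simp add: algebra_simps)
qed

lemma has_wirtinger_holomorphic:
  assumes "(f has_field_derivative d) (at z)"
  shows "has_wirtinger f d z"
  using assms unfolding has_wirtinger_def has_field_derivative_def
  by (intro exI[of _ 0]) simp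

lemma has_wirtinger_const_mult:
  assumes "has_wirtinger f d z"
  shows "has_wirtinger (\<lambda>w. c * f w) (c * d) z"
proof -
  obtain e where e: "(f has_derivative (\<lambda>h. d * h + e * cnj h)) (at z)"
    using assms by (auto simp: has_wirtinger_def)
  have "((\<lambda>w. c * f w) has_derivative (\<lambda>h. c * (d * h + e * cnj h))) (at z)"
    by (intro has_derivative_mult_right e)
  then show ?thesis
    by (auto simp: has_wirtinger_def algebra_simps intro!: exI[of _ "c * e"])
qed

lemma has_wirtinger_mult:
  assumes "has_wirtinger f a z" and "has_wirtinger g b z"
  shows "has_wirtinger (\<lambda>w. f w * g w) (a * g z + f z * b) z"
proof -
  obtain a' b' where
    f: "(f has_derivative (\<lambda>h. a * h + a' * cnj h)) (at z)" and
    g: "(g has_derivative (\<lambda>h. b * h + b' * cnj h)) (at z)"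
    using assms by (auto simp: has_wirtinger_def)
  have "((\<lambda>w. f w * g w) has_derivative
      (\<lambda>h. (a * g z + f z * b) * h + (a' * g z + f z * b') * cnj h)) (at z)"
    by (rule has_derivative_eq_rhs[OF has_derivative_mult[OF f g]]) (auto simp: algebra_simps)
  then show ?thesis
    by (auto simp: has_wirtinger_def)
qed

lemma has_wirtinger_sum:
  assumes "\<And>i. i \<in> A \<Longrightarrow> has_wirtinger (f i) (d i) z"
  shows "has_wirtinger (\<lambda>w. \<Sum>i\<in>A. f i w) (\<Sum>i\<in>A. d i) z"
proof -
  obtain e where e: "\<And>i. i \<in> A \<Longrightarrow> (f i has_derivative (\<lambda>h. d i * h + e i * cnj h)) (at z)"
    using assms unfolding has_wirtinger_def by metis
  have "((\<lambda>w. \<Sum>i\<in>A. f i w) has_derivative (\<lambda>h. \<Sum>i\<in>A. d i * h + e i * cnj h)) (at z)"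
    by (rule has_derivative_sum[OF e])
  then show ?thesis
    unfolding has_wirtinger_def
    by (intro exI[of _ "\<Sum>i\<in>A. e i"]) (simp add: sum.distrib sum_distrib_right)
qed

lemma has_wirtinger_transform:
  assumes "has_wirtinger f d z" and "open V" and "z \<in> V" and "\<And>w. w \<in> V \<Longrightarrow> f w = g w"
  shows "has_wirtinger g d z"
  using assms has_derivative_transform_within_open unfolding has_wirtinger_def by blast

text \<open>Pascal's rule for the step of the Leibniz formula: \<open>a i k\<close> stands for the product of the \<open>i\<close>-th
  derivative of one factor with the \<open>k\<close>-th derivative of the other.\<close>

lemma binomial_sum_step:
  fixes a :: "nat \<Rightarrow> nat \<Rightarrow> 'a :: comm_semiring_1"
  shows "(\<Sum>k\<le>m. of_nat (m choose k) * (a (Suc (m - k)) k + a (m - k) (Suc k)))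
       = (\<Sum>k\<le>Suc m. of_nat (Suc m choose k) * a (Suc m - k) k)"
proof -
  have shift: "(\<Sum>k\<le>m. of_nat (m choose k) * a (Suc (m - k)) k)
      = a (Suc m) 0 + (\<Sum>k\<le>m. of_nat (m choose Suc k) * a (m - k) (Suc k))"
  proof -
    have "(\<Sum>k\<le>m. of_nat (m choose k) * a (Suc (m - k)) k)
        = (\<Sum>k\<le>Suc m. of_nat (m choose k) * a (Suc m - k) k)"
      by (simp add: Suc_diff_le binomial_eq_0)
    then show ?thesis
      by (simp add: sum.atMost_Suc_shift del: sum.atMost_Suc)
  qed
  have "(\<Sum>k\<le>Suc m. of_nat (Suc m choose k) * a (Suc m - k) k)
      = a (Suc m) 0 + (\<Sum>k\<le>m. of_nat (m choose Suc k) * a (m - k) (Suc k))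
        + (\<Sum>k\<le>m. of_nat (m choose k) * a (m - k) (Suc k))"
    by (simp add: sum.atMost_Suc_shift algebra_simps sum.distrib del: sum.atMost_Suc)
  then show ?thesis
    by (simp only: distrib_left sum.distrib shift)
qed

text \<open>The hypotheses are asked on an open set rather than at \<open>w\<close> alone: differentiating the
  \<open>m\<close>-th derivative once more requires its formula on a neighbourhood.\<close>

lemma wirtinger_Leibniz:
  fixes F G :: "nat \<Rightarrow> complex \<Rightarrow> complex"
  assumes "open V"
    and F: "\<And>i w. w \<in> V \<Longrightarrow> has_wirtinger (F i) (F (Suc i) w) w"
    and G: "\<And>i w. w \<in> V \<Longrightarrow> has_wirtinger (G i) (G (Suc i) w) w"
    and "w \<in> V"
  shows "(wirtinger ^^ m) (\<lambda>w. F 0 w * G 0 w) w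
       = (\<Sum>k\<le>m. of_nat (m choose k) * (F (m - k) w * G k w))"
  using \<open>w \<in> V\<close>
proof (induction m arbitrary: w)
  case 0
  then show ?case by simp
next
  case (Suc m)
  have "has_wirtinger (\<lambda>w. \<Sum>k\<le>m. of_nat (m choose k) * (F (m - k) w * G k w))
      (\<Sum>k\<le>m. of_nat (m choose k) * (F (Suc (m - k)) w * G k w + F (m - k) w * G (Suc k) w)) w"
    by (intro has_wirtinger_sum has_wirtinger_const_mult has_wirtinger_mult F G Suc.prems)
  then have "has_wirtinger ((wirtinger ^^ m) (\<lambda>w. F 0 w * G 0 w))
      (\<Sum>k\<le>m. of_nat (m choose k) * (F (Suc (m - k)) w * G k w + F (m - k) w * G (Suc k) w)) w"
    by (rule has_wirtinger_transform[OF _ \<open>open V\<close> Suc.prems]) (simp add: Suc.IH)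
  then show ?case
    using binomial_sum_step[of m "\<lambda>i k. F i w * G k w"]
    by (simp add: wirtinger_eqI)
qed

section \<open>Derivatives of the two power functions\<close>

text \<open>A branch is only assumed to be continuous; it is a local right inverse of the exponential
  function, whose derivative does not vanish, and is therefore holomorphic.\<close>

lemma log_branch_has_field_derivative:
  assumes "log_branch_on U L" and "z \<in> U"
  shows "(L has_field_derivative 1 / z) (at z)"
proof -
  have L: "open U" "continuous_on U L" "\<And>w. w \<in> U \<Longrightarrow> exp (L w) = w"
    using assms by (auto simp: log_branch_on_def)
  have "z \<noteq> 0"
    using L(3)[OF assms(2)] by (metis exp_not_eq_zero)
  have "isCont L z"
    using L assms(2) by (simp add: continuous_on_eq_continuous_at)
  then have "(L has_field_derivative inverse (exp (L z))) (at z)"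
    by (intro has_field_derivative_inverse_basic[of exp, OF DERIV_exp]) (use L assms(2) \<open>z \<noteq> 0\<close> in auto)
  then show ?thesis
    using L assms(2) by (simp add: divide_inverse)
qed

lemma has_wirtinger_branch_power:
  fixes s :: real
  assumes "log_branch_on U L" and "z \<in> U"
  shows "has_wirtinger (\<lambda>w. exp (complex_of_real s * L w))
           (complex_of_real s * exp (complex_of_real (s - 1) * L z)) z"
proof -
  have "exp (L z) = z"
    using assms by (simp add: log_branch_on_def)
  then have "exp (complex_of_real (s - 1) * L z) = exp (complex_of_real s * L z) / z"
    by (simp add: left_diff_distrib exp_diff)
  moreover have "((\<lambda>w. exp (complex_of_real s * L w)) has_field_derivative
      complex_of_real s * (exp (complex_of_real s * L z) / z)) (at z)"
    by (auto intro!: derivative_eq_intros log_branch_has_field_derivative[OF assms])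
  ultimately show ?thesis
    by (metis has_wirtinger_holomorphic)
qed

text \<open>By \<open>\<bar>w\<bar>\<^sup>2 = w cnj w\<close>, the Wirtinger derivative of \<open>1 - \<bar>w\<bar>\<^sup>2\<close> is \<open>- cnj w\<close>.\<close>

lemma has_wirtinger_disc_power:
  fixes p :: real
  assumes "norm z < 1"
  shows "has_wirtinger (\<lambda>w. complex_of_real ((1 - (norm w)\<^sup>2) powr p))
           (- cnj z * of_real (p * (1 - (norm z)\<^sup>2) powr (p - 1))) z"
proof -
  define q where "q = p * (1 - (norm z)\<^sup>2) powr (p - 1)"
  have "0 < 1 - (norm z)\<^sup>2"
    using assms by (simp add: power_less_one_iff abs_square_less_1)
  then have outer: "((\<lambda>x. x powr p) has_derivative (\<lambda>h. q * h)) (at (1 - (norm z)\<^sup>2))"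
    using has_real_derivative_powr unfolding q_def has_field_derivative_def by blast
  have inner: "((\<lambda>w. 1 - (norm w)\<^sup>2) has_derivative (\<lambda>h. - 2 * inner z h)) (at z)"
    unfolding power2_norm_eq_inner
    by (auto intro!: derivative_eq_intros simp: inner_commute)
  have "((\<lambda>w. complex_of_real ((1 - (norm w)\<^sup>2) powr p)) has_derivative
      (\<lambda>h. complex_of_real (q * (- 2 * inner z h)))) (at z)"
    by (intro has_derivative_of_real has_derivative_compose[OF inner outer])
  moreover have "complex_of_real (q * (- 2 * inner z h))
      = (- cnj z * of_real q) * h + (- z * of_real q) * cnj h" for h
    by (simp add: complex_eq_iff inner_complex_def algebra_simps)
  ultimately have "((\<lambda>w. complex_of_real ((1 - (norm w)\<^sup>2) powr p)) has_derivative
      (\<lambda>h. (- cnj z * of_real q) * h + (- z * of_real q) * cnj h)) (at z)"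
    by (simp only:)
  then show ?thesis
    unfolding has_wirtinger_def q_def[symmetric] by blast
qed

lemma fact_Suc_gchoose_Suc:
  "fact (Suc k) * (a gchoose Suc k) = (fact k * (a gchoose k)) * (a - of_nat k)"
  for a :: "'a :: field_char_0"
  by (simp only: gbinomial_mult_fact) simp

text \<open>In this lemma and the next one the functions indexed by \<open>i\<close> are the \<open>i\<close>-th derivatives of the
  two power functions. The falling factorials are written as \<open>fact i * (s gchoose i)\<close>, so that the
  factorials later cancel against the binomial coefficient of the Leibniz rule.\<close>

lemma has_wirtinger_branch_power_iterate:
  fixes s :: real
  assumes "log_branch_on U L" and "z \<in> U"
  shows "has_wirtinger
    (\<lambda>w. complex_of_real (fact i * (s gchoose i)) * exp (complex_of_real (s - real i) * L w))
    (complex_of_real (fact (Suc i) * (s gchoose Suc i)) * exp (complex_of_real (s - real (Suc i)) * L z)) z"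
proof -
  have *: "s - real (Suc i) = s - real i - 1" by simp
  show ?thesis
    using has_wirtinger_const_mult[OF has_wirtinger_branch_power[OF assms, of "s - real i"],
        of "complex_of_real (fact i * (s gchoose i))"]
    unfolding fact_Suc_gchoose_Suc * of_real_mult[of _ "s - real i"] by (simp add: mult.assoc)
qed

lemma has_wirtinger_disc_power_iterate:
  fixes p :: real
  assumes "norm z < 1"
  shows "has_wirtinger
    (\<lambda>w. complex_of_real (fact i * (p gchoose i)) * (- cnj w) ^ i
         * complex_of_real ((1 - (norm w)\<^sup>2) powr (p - real i)))
    (complex_of_real (fact (Suc i) * (p gchoose Suc i)) * (- cnj z) ^ Suc i
         * complex_of_real ((1 - (norm z)\<^sup>2) powr (p - real (Suc i)))) z"
proof -
  have *: "p - real (Suc i) = p - real i - 1" by simp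
  have "((\<lambda>w. (- cnj w) ^ i) has_derivative
      (\<lambda>h. 0 * h + (- of_nat i * (- cnj z) ^ (i - 1)) * cnj h)) (at z)"
    by (auto intro!: derivative_eq_intros bounded_linear.has_derivative[OF bounded_linear_cnj])
  \<comment> \<open>powers of the conjugate are constants for the Wirtinger derivative\<close>
  then have "has_wirtinger (\<lambda>w. (- cnj w) ^ i) 0 z"
    unfolding has_wirtinger_def by blast
  from has_wirtinger_mult[OF has_wirtinger_const_mult[OF this,
        of "complex_of_real (fact i * (p gchoose i))"]
      has_wirtinger_disc_power[OF assms, of "p - real i"]]
  show ?thesis
    unfolding fact_Suc_gchoose_Suc * of_real_mult[of _ "p - real i"] by (simp add: mult_ac)
qed


section \<open>Jacobi polynomials\<close>

text \<open>The expression of a Jacobi polynomial as a homogeneous form in \<open>x\<close> and \<open>1 - x\<close>. Expanding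
  \<open>(1 - x)\<^sup>k\<close> (\<open>binom\<close>), the coefficient of \<open>(-x)\<close> to the power \<open>m - i\<close> is
  \[ \sum_k {m+a \choose k}{m+b \choose m-k}{k \choose i}
     = {m+a \choose i} \sum_k {m+a-i \choose k-i}{m+b \choose m-k}
     = {m+a \choose i}{2m+a+b-i \choose m-i} , \]
  by trinomial revision and Vandermonde's convolution (\<open>vand\<close>); up to
  the sign, this is the coefficient of \<open>x\<close> to the power \<open>m - i\<close> in the hypergeometric polynomial
  (\<open>coeff\<close>). The condition on \<open>a\<close> keeps the denominators there away from zero.\<close>

lemma jacobi_P_gchoose_sum:
  fixes a b x :: real
  assumes "a > -1"
  shows "jacobi_P m a b (1 - 2 * x)
       = (\<Sum>k\<le>m. ((real m + a) gchoose k) * ((real m + b) gchoose (m - k)) * (- x) ^ (m - k) * (1 - x) ^ k)"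
proof -
  define s where "s = real m + a + b + 1"
  define h where "h l = pochhammer (- real m) l * pochhammer s l / (pochhammer (a + 1) l * fact l)" for l
  have pos: "pochhammer (a + 1) l > 0" for l
    using assms by (intro pochhammer_pos) simp
  have hyp: "jacobi_P m a b (1 - 2 * x) = (\<Sum>l\<le>m. pochhammer (a + 1) m / fact m * h l * x ^ l)"
  proof -
    have "eval_fps (fps_hypergeo [- real m, s] [a + 1] 1) x = (\<Sum>l. h l * x ^ l)"
      by (simp add: eval_fps_def h_def)
    also have "\<dots> = (\<Sum>l\<le>m. h l * x ^ l)"
      by (rule suminf_finite) (auto simp: h_def pochhammer_of_nat_eq_0_iff)
    finally show ?thesis
      by (simp add: jacobi_P_def s_def sum_distrib_left mult.assoc)
  qed
  have coeff: "pochhammer (a + 1) m / fact m * h (m - i) * (-1) ^ (m - i)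
      = ((real m + a) gchoose i) * ((real m + a - real i + (real m + b)) gchoose (m - i))"
    if "i \<le> m" for i
  proof -
    define sg where "sg = (-1 :: real) ^ (m - i)"
    have sg: "sg * sg = 1"
      unfolding sg_def by (simp flip: power_mult_distrib)
    have up: "pochhammer (a + 1) m = pochhammer (a + 1) (m - i) * pochhammer (a + 1 + real (m - i)) i"
      using pochhammer_product[of "m - i" m "a + 1"] that by simp
    have gi: "(real m + a) gchoose i = pochhammer (a + 1 + real (m - i)) i / fact i"
      using that by (simp add: gbinomial_pochhammer' of_nat_diff algebra_simps)
    have gs: "(real m + a - real i + (real m + b)) gchoose (m - i) = pochhammer s (m - i) / fact (m - i)"
      using that by (simp add: gbinomial_pochhammer' s_def of_nat_diff algebra_simps)
    have dn: "pochhammer (- real m) (m - i) = sg * (fact m / fact i)"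
    proof -
      have "real (m choose (m - i)) = sg * pochhammer (- real m) (m - i) / fact (m - i)"
        by (simp add: binomial_gbinomial gbinomial_pochhammer sg_def)
      moreover have "real (m choose (m - i)) = fact m / (fact (m - i) * fact i)"
        using that by (simp add: binomial_fact)
      ultimately have "sg * pochhammer (- real m) (m - i) = fact m / fact i"
        by (simp add: field_simps)
      then have "sg * sg * pochhammer (- real m) (m - i) = sg * (fact m / fact i)"
        by (simp add: mult.assoc)
      then show ?thesis
        by (simp add: sg)
    qed
    have "pochhammer (a + 1) m / fact m * h (m - i) * sg
        = sg * sg * (pochhammer (a + 1 + real (m - i)) i / fact i) * (pochhammer s (m - i) / fact (m - i))"
      using pos[of "m - i"] unfolding h_def up dn by (simp add: field_simps)
    then show ?thesis
      unfolding sg gi gs sg_def by simp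
  qed
  have vand: "(\<Sum>k\<le>m. ((real m + a) gchoose k) * ((real m + b) gchoose (m - k)) * real (k choose i))
      = ((real m + a) gchoose i) * ((real m + a - real i + (real m + b)) gchoose (m - i))"
    if "i \<le> m" for i
  proof -
    have "(\<Sum>k\<le>m. ((real m + a) gchoose k) * ((real m + b) gchoose (m - k)) * real (k choose i))
        = (\<Sum>k=i..m. ((real m + a) gchoose k) * ((real m + b) gchoose (m - k)) * real (k choose i))"
      by (rule sum.mono_neutral_right) (auto simp: binomial_eq_0)
    also have "\<dots> = (\<Sum>k=i..m. ((real m + a) gchoose i) *
        (((real m + a - real i) gchoose (k - i)) * ((real m + b) gchoose (m - k))))"
      using gbinomial_trinomial_revision[of i _ "real m + a"]
      by (intro sum.cong) (auto simp: binomial_gbinomial mult_ac)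
    also have "\<dots> = ((real m + a) gchoose i) *
        (\<Sum>j=0..m - i. ((real m + a - real i) gchoose j) * ((real m + b) gchoose (m - i - j)))"
      unfolding sum_distrib_left[symmetric]
      using that
      by (intro arg_cong2[of _ _ _ _ "(*)"] refl
          sum.reindex_bij_witness[of _ "\<lambda>j. j + i" "\<lambda>k. k - i"]) auto
    finally show ?thesis
      by (simp only: gbinomial_Vandermonde)
  qed
  have binom: "(- x) ^ (m - k) * (1 - x) ^ k = (\<Sum>i\<le>m. real (k choose i) * (- x) ^ (m - i))"
    if "k \<le> m" for k
  proof -
    have "(1 - x) ^ k = (\<Sum>i\<le>k. real (k choose i) * (- x) ^ (k - i))"
      using binomial_ring[of 1 "- x" k] by simp
    then have "(- x) ^ (m - k) * (1 - x) ^ k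
        = (\<Sum>i\<le>k. real (k choose i) * ((- x) ^ (m - k) * (- x) ^ (k - i)))"
      by (simp add: sum_distrib_left mult_ac)
    also have "\<dots> = (\<Sum>i\<le>k. real (k choose i) * (- x) ^ (m - i))"
      using that by (simp flip: power_add)
    also have "\<dots> = (\<Sum>i\<le>m. real (k choose i) * (- x) ^ (m - i))"
      using that by (intro sum.mono_neutral_left) (auto simp: binomial_eq_0)
    finally show ?thesis .
  qed
  have "(\<Sum>k\<le>m. ((real m + a) gchoose k) * ((real m + b) gchoose (m - k)) * (- x) ^ (m - k) * (1 - x) ^ k)
      = (\<Sum>k\<le>m. \<Sum>i\<le>m. ((real m + a) gchoose k) * ((real m + b) gchoose (m - k)) * real (k choose i)
           * (- x) ^ (m - i))"
    using binom by (simp add: mult.assoc sum_distrib_left)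
  also have "\<dots> = (\<Sum>i\<le>m. (\<Sum>k\<le>m. ((real m + a) gchoose k) * ((real m + b) gchoose (m - k))
           * real (k choose i)) * (- x) ^ (m - i))"
    by (subst sum.swap) (simp add: sum_distrib_right)
  also have "\<dots> = (\<Sum>i\<le>m. pochhammer (a + 1) m / fact m * h (m - i) * x ^ (m - i))"
  proof (rule sum.cong[OF refl])
    fix i assume "i \<in> {..m}"
    then have "i \<le> m" by simp
    have "(- x) ^ (m - i) = (-1) ^ (m - i) * x ^ (m - i)"
      by (rule power_minus)
    moreover have "(-1) ^ (m - i) * ((-1) ^ (m - i) * c) = c" for c :: real
      by (simp flip: mult.assoc power_mult_distrib)
    ultimately show "(\<Sum>k\<le>m. ((real m + a) gchoose k) * ((real m + b) gchoose (m - k))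
           * real (k choose i)) * (- x) ^ (m - i)
        = pochhammer (a + 1) m / fact m * h (m - i) * x ^ (m - i)"
      unfolding vand[OF \<open>i \<le> m\<close>] coeff[OF \<open>i \<le> m\<close>, symmetric] by (simp only: mult.assoc)
  qed
  also have "\<dots> = jacobi_P m a b (1 - 2 * x)"
    unfolding hyp
    by (rule sum.reindex_bij_witness[of _ "\<lambda>i. m - i" "\<lambda>i. m - i"]) auto
  finally show ?thesis
    by simp
qed

text \<open>The falling factorial of \<open>m + a\<close> with \<open>m - N + j\<close> factors runs from \<open>m + a\<close> down to
  \<open>N + a - j + 1\<close>; it is cut here between \<open>N + a + 1\<close> and \<open>N + a\<close>.\<close>

lemma fact_gchoose_split:
  fixes a :: real
  assumes "N \<le> m" and "j \<le> N"
  shows "fact (m - N + j) * ((real m + a) gchoose (m - N + j))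
       = fact j * ((real N + a) gchoose j) * pochhammer (a + 1 + real N) (m - N)"
proof -
  have "pochhammer (real N + a - real j + 1) (j + (m - N))
      = pochhammer (real N + a - real j + 1) j * pochhammer (a + 1 + real N) (m - N)"
    by (simp add: pochhammer_product' add_ac)
  then show ?thesis
    using assms by (simp add: gbinomial_pochhammer' of_nat_diff algebra_simps)
qed

text \<open>If the second parameter is \<open>N - m\<close>, the coefficient \<open>real N gchoose (m - k)\<close> kills the terms with
  \<open>k < m - N\<close>. The substitution \<open>k = m - N + j\<close> makes \<open>t ^ (m - N)\<close> a common factor, and
  the remaining coefficients are proportional to those of \<open>P\<^sub>N\<close> with second
  parameter \<open>m - N\<close>, by a factor that does not depend on \<open>j\<close>.\<close>

lemma jacobi_P_negative_integer_parameter: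
  fixes a t :: real
  assumes "a > -1" and "N \<le> m"
  shows "fact m * jacobi_P m a (real N - real m) (2 * t - 1)
       = fact N * pochhammer (a + 1) m / pochhammer (a + 1) N * t ^ (m - N)
         * jacobi_P N a (real m - real N) (2 * t - 1)"
proof -
  define x where "x = 1 - t"
  define C where "C = pochhammer (a + 1 + real N) (m - N)"
  have y: "2 * t - 1 = 1 - 2 * x" and t: "1 - x = t"
    by (simp_all add: x_def)
  have "pochhammer (a + 1) N > 0"
    using assms(1) by (intro pochhammer_pos) simp
  then have C: "pochhammer (a + 1) m / pochhammer (a + 1) N = C"
    using pochhammer_product[OF assms(2), of "a + 1"] by (simp add: C_def)
  have "jacobi_P m a (real N - real m) (2 * t - 1)
      = (\<Sum>k\<le>m. ((real m + a) gchoose k) * (real N gchoose (m - k)) * (- x) ^ (m - k) * t ^ k)"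
    unfolding y jacobi_P_gchoose_sum[OF assms(1)] t by simp
  also have "\<dots> = (\<Sum>k=m-N..m. ((real m + a) gchoose k) * (real N gchoose (m - k)) * (- x) ^ (m - k) * t ^ k)"
    by (rule sum.mono_neutral_right) (auto simp: binomial_eq_0 simp flip: binomial_gbinomial)
  also have "\<dots> = (\<Sum>j\<le>N. ((real m + a) gchoose (m - N + j)) * (real N gchoose (N - j)) * (- x) ^ (N - j) * t ^ (m - N + j))"
    using assms(2)
    by (intro sum.reindex_bij_witness[of _ "\<lambda>j. m - N + j" "\<lambda>k. k - (m - N)"]) auto
  finally have "fact m * jacobi_P m a (real N - real m) (2 * t - 1)
      = (\<Sum>j\<le>N. fact m * (((real m + a) gchoose (m - N + j)) * (real N gchoose (N - j)))
           * (- x) ^ (N - j) * t ^ (m - N + j))"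
    by (simp add: sum_distrib_left mult.assoc)
  also have "\<dots> = (\<Sum>j\<le>N. fact N * C * (((real N + a) gchoose j) * (real m gchoose (N - j)))
           * (- x) ^ (N - j) * t ^ (m - N + j))"
  proof (rule sum.cong[OF refl])
    fix j assume "j \<in> {..N}"
    then have j: "j \<le> N" by simp
    have gN: "real N gchoose (N - j) = fact N / (fact (N - j) * fact j)"
      using j by (simp add: binomial_fact flip: binomial_gbinomial)
    have gm: "real m gchoose (N - j) = fact m / (fact (N - j) * fact (m - N + j))"
      using j assms(2) by (simp add: binomial_fact flip: binomial_gbinomial)
    have ga: "(real m + a) gchoose (m - N + j)
        = fact j * ((real N + a) gchoose j) * C / fact (m - N + j)"
      using fact_gchoose_split[OF assms(2) j, of a] by (simp add: C_def field_simps)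
    have "fact m * (((real m + a) gchoose (m - N + j)) * (real N gchoose (N - j)))
        = fact N * C * (((real N + a) gchoose j) * (real m gchoose (N - j)))"
      unfolding gN gm ga by (simp add: field_simps)
    then show "fact m * (((real m + a) gchoose (m - N + j)) * (real N gchoose (N - j)))
           * (- x) ^ (N - j) * t ^ (m - N + j)
        = fact N * C * (((real N + a) gchoose j) * (real m gchoose (N - j)))
           * (- x) ^ (N - j) * t ^ (m - N + j)"
      by (simp only:)
  qed
  also have "\<dots> = fact N * C * t ^ (m - N) * (\<Sum>j\<le>N. ((real N + a) gchoose j) * (real m gchoose (N - j))
           * (- x) ^ (N - j) * t ^ j)"
    by (simp add: sum_distrib_left power_add mult_ac)
  also have "(\<Sum>j\<le>N. ((real N + a) gchoose j) * (real m gchoose (N - j)) * (- x) ^ (N - j) * t ^ j)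
      = jacobi_P N a (real m - real N) (2 * t - 1)"
    unfolding y jacobi_P_gchoose_sum[OF assms(1)] t by simp
  finally show ?thesis
    unfolding C[symmetric] by simp
qed

section \<open>Zernike functions\<close>

text \<open>In the \<open>k\<close>-th term of the Leibniz rule the non-integral exponents cancel against the prefactors:
  what is left of the branch of the logarithm is the integral power \<open>z powi (n - m + k)\<close>, and
  what is left of the powers of \<open>1 - \<bar>z\<bar>\<^sup>2\<close> has exponent \<open>m - k\<close>. The \<open>k\<close> extra factors \<open>z\<close>
  combine with those of \<open>cnj z\<close>.\<close>

lemma zernike_gchoose_sum:
  fixes \<kappa> \<rho> :: real
  assumes "log_branch_on U L" and "z \<in> U" and "norm z < 1"
  shows "zernike L \<kappa> \<rho> m n z = fact m * z powi (n - int m) * complex_of_real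
    (\<Sum>k\<le>m. ((real m + \<kappa>) gchoose k) * ((of_int n + \<rho>) gchoose (m - k))
          * (- (1 - (norm z)\<^sup>2)) ^ (m - k) * ((norm z)\<^sup>2) ^ k)"
proof -
  define s where "s = of_int n + \<rho>"
  define p where "p = \<kappa> + real m"
  define x where "x = 1 - (norm z)\<^sup>2"
  define F where "F i w = complex_of_real (fact i * (s gchoose i))
      * exp (complex_of_real (s - real i) * L w)" for i w
  define G where "G i w = complex_of_real (fact i * (p gchoose i)) * (- cnj w) ^ i
      * complex_of_real ((1 - (norm w)\<^sup>2) powr (p - real i))" for i w
  have expL: "exp (L z) = z"
    using assms by (simp add: log_branch_on_def)
  then have "z \<noteq> 0"
    by (metis exp_not_eq_zero)
  have "x > 0"
    using assms(3) by (simp add: x_def power_less_one_iff abs_square_less_1)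
  have "(wirtinger ^^ m) (\<lambda>w. F 0 w * G 0 w) z
      = (\<Sum>k\<le>m. of_nat (m choose k) * (F (m - k) z * G k z))"
  proof (rule wirtinger_Leibniz[of "U \<inter> ball 0 1"])
    show "open (U \<inter> ball 0 1)"
      using assms(1) by (auto simp: log_branch_on_def)
    show "has_wirtinger (F i) (F (Suc i) w) w" if "w \<in> U \<inter> ball 0 1" for i w
      using has_wirtinger_branch_power_iterate[OF assms(1)] that unfolding F_def by blast
    show "has_wirtinger (G i) (G (Suc i) w) w" if "w \<in> U \<inter> ball 0 1" for i w
      using has_wirtinger_disc_power_iterate that unfolding G_def by simp
  qed (use assms in auto)
  then have "zernike L \<kappa> \<rho> m n z = (\<Sum>k\<le>m. (-1) ^ m * exp (complex_of_real (- \<rho>) * L z)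
      * complex_of_real (x powr (- \<kappa>)) * (of_nat (m choose k) * (F (m - k) z * G k z)))"
    by (simp add: zernike_def F_def G_def s_def p_def x_def sum_distrib_left)
  also have "\<dots> = (\<Sum>k\<le>m. fact m * z powi (n - int m) * complex_of_real
      ((p gchoose k) * (s gchoose (m - k)) * (- x) ^ (m - k) * ((norm z)\<^sup>2) ^ k))"
  proof (intro sum.cong refl)
    fix k assume "k \<in> {..m}"
    then have k: "k \<le> m" by simp
    have fct: "of_nat (m choose k) * complex_of_real (fact (m - k)) * complex_of_real (fact k) = fact m"
      using k by (simp add: binomial_fact)
    have pw: "exp (complex_of_real (- \<rho>) * L z) * exp (complex_of_real (s - real (m - k)) * L z)
        = z powi (n - int m) * z ^ k"
    proof -
      have "exp (complex_of_real (- \<rho>) * L z) * exp (complex_of_real (s - real (m - k)) * L z)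
          = exp (of_int (n - int m + int k) * L z)"
        using k by (simp add: s_def of_nat_diff algebra_simps flip: exp_add)
      also have "\<dots> = z powi (n - int m + int k)"
        by (simp only: exp_power_int[symmetric] expL)
      finally show ?thesis
        using \<open>z \<noteq> 0\<close> by (simp add: power_int_add)
    qed
    have xp: "complex_of_real (x powr (- \<kappa>)) * complex_of_real (x powr (p - real k))
        = complex_of_real (x ^ (m - k))"
    proof -
      have "x powr (- \<kappa>) * x powr (p - real k) = x powr real (m - k)"
        using k by (simp add: p_def of_nat_diff algebra_simps flip: powr_add)
      then show ?thesis
        using \<open>x > 0\<close> by (simp add: powr_realpow flip: of_real_mult)
    qed
    have sgn: "(-1) ^ m * (- cnj z) ^ k * z ^ k * complex_of_real (x ^ (m - k))
        = complex_of_real ((- x) ^ (m - k) * ((norm z)\<^sup>2) ^ k)"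
    proof -
      have "(-1 :: complex) ^ m = (-1) ^ (m - k) * (-1) ^ k"
        using k by (simp flip: power_add)
      then have "(-1) ^ m * (- cnj z) ^ k * z ^ k * complex_of_real (x ^ (m - k))
          = ((-1) * of_real x) ^ (m - k) * ((-1) * (- cnj z) * z) ^ k"
        by (simp only: power_mult_distrib of_real_power mult_ac)
      also have "(-1) * (- cnj z) * z = complex_of_real ((norm z)\<^sup>2)"
        using complex_norm_square[of z] by (simp add: mult.commute)
      finally show ?thesis
        by simp
    qed
    have "(-1) ^ m * exp (complex_of_real (- \<rho>) * L z) * complex_of_real (x powr (- \<kappa>))
          * (of_nat (m choose k) * (F (m - k) z * G k z))
        = (of_nat (m choose k) * complex_of_real (fact (m - k)) * complex_of_real (fact k))
          * complex_of_real (p gchoose k) * complex_of_real (s gchoose (m - k))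
          * (exp (complex_of_real (- \<rho>) * L z) * exp (complex_of_real (s - real (m - k)) * L z))
          * (complex_of_real (x powr (- \<kappa>)) * complex_of_real (x powr (p - real k)))
          * ((-1) ^ m * (- cnj z) ^ k)"
      unfolding F_def G_def x_def by (simp only: of_real_mult mult_ac)
    also have "\<dots> = fact m * z powi (n - int m) * (complex_of_real (p gchoose k)
          * complex_of_real (s gchoose (m - k))
          * ((-1) ^ m * (- cnj z) ^ k * z ^ k * complex_of_real (x ^ (m - k))))"
      unfolding fct pw xp by (simp only: mult_ac)
    also have "\<dots> = fact m * z powi (n - int m) * complex_of_real
      ((p gchoose k) * (s gchoose (m - k)) * (- x) ^ (m - k) * ((norm z)\<^sup>2) ^ k)"
      unfolding sgn by (simp only: of_real_mult mult_ac)
    finally show "(-1) ^ m * exp (complex_of_real (- \<rho>) * L z) * complex_of_real (x powr (- \<kappa>))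
          * (of_nat (m choose k) * (F (m - k) z * G k z))
        = fact m * z powi (n - int m) * complex_of_real
      ((p gchoose k) * (s gchoose (m - k)) * (- x) ^ (m - k) * ((norm z)\<^sup>2) ^ k)" .
  qed
  finally show ?thesis
    by (simp add: sum_distrib_left s_def p_def x_def add.commute)
qed

lemma zernike_eq_jacobi_P:
  fixes \<kappa> \<rho> :: real
  assumes "\<kappa> > -1" and "log_branch_on U L" and "z \<in> U" and "norm z < 1"
  shows "zernike L \<kappa> \<rho> m n z = fact m * z powi (n - int m)
    * complex_of_real (jacobi_P m \<kappa> (of_int n - real m + \<rho>) (2 * (norm z)\<^sup>2 - 1))"
proof -
  have y: "2 * (norm z)\<^sup>2 - 1 = 1 - 2 * (1 - (norm z)\<^sup>2)"
    by simp
  show ?thesis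
    unfolding zernike_gchoose_sum[OF assms(2-4)] y jacobi_P_gchoose_sum[OF assms(1)]
    by (simp add: algebra_simps)
qed

lemma powi_diff_eq_cnj:
  assumes "z \<noteq> 0"
  shows "z powi (n - int m) = z powi n * cnj z ^ m / complex_of_real (norm z ^ (2 * m))"
proof -
  have "complex_of_real (norm z ^ (2 * m)) = z ^ m * cnj z ^ m"
    using complex_norm_square[of z] by (simp add: power_mult flip: power_mult_distrib)
  then show ?thesis
    using assms by (simp add: power_int_diff)
qed

theorem proposition3p5:
  fixes \<rho> \<kappa> :: real and m :: nat and n :: int and z :: complex
    and U :: "complex set" and L :: "complex \<Rightarrow> complex"
  assumes "\<rho> > -1" and "\<kappa> > -1" and "of_int n + \<rho> \<ge> 0"
    and "0 < norm z" and "norm z < 1"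
    and "z \<in> U" and "log_branch_on U L"
  shows "(\<forall>r::nat. \<rho> = real r \<longrightarrow>
            (let N = nat (n + int r) in
              zernike L \<kappa> \<rho> m n z =
                complex_of_real (pochhammer (\<kappa> + 1) (max m N) * fact (min m N) / pochhammer (\<kappa> + 1) N)
                * (z powi n * cnj z ^ m / complex_of_real (norm z ^ (2 * min m N)))
                * complex_of_real
                    (jacobi_P (min m N) \<kappa> \<bar>real m - of_int n - \<rho>\<bar> (2 * (norm z)\<^sup>2 - 1))))
       \<and> (\<rho> \<notin> \<int> \<or> real m = min (real m) (of_int n + \<rho>) \<longrightarrow>
            zernike L \<kappa> \<rho> m n z =
              fact m * z powi (n - int m)
              * complex_of_real (jacobi_P m \<kappa> (of_int n - real m + \<rho>) (2 * (norm z)\<^sup>2 - 1)))"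
proof (intro conjI allI impI)
  have "z \<noteq> 0"
    using assms(4) by auto
  note zernike = zernike_eq_jacobi_P[OF assms(2,7,6,5), of \<rho> m n]
  show "zernike L \<kappa> \<rho> m n z = fact m * z powi (n - int m)
      * complex_of_real (jacobi_P m \<kappa> (of_int n - real m + \<rho>) (2 * (norm z)\<^sup>2 - 1))"
    by (rule zernike)
  fix r :: nat
  assume r: "\<rho> = real r"
  define N where "N = nat (n + int r)"
  have N: "real N = of_int n + \<rho>"
    using assms(3) r by (simp add: N_def)
  have pos: "pochhammer (\<kappa> + 1) N > 0"
    using assms(2) by (intro pochhammer_pos) simp
  have "zernike L \<kappa> \<rho> m n z =
      complex_of_real (pochhammer (\<kappa> + 1) (max m N) * fact (min m N) / pochhammer (\<kappa> + 1) N)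
      * (z powi n * cnj z ^ m / complex_of_real (norm z ^ (2 * min m N)))
      * complex_of_real
          (jacobi_P (min m N) \<kappa> \<bar>real m - of_int n - \<rho>\<bar> (2 * (norm z)\<^sup>2 - 1))"
  proof (cases "m \<le> N")
    case True
    then have "\<bar>real m - of_int n - \<rho>\<bar> = of_int n - real m + \<rho>"
      using N by simp
    with True pos show ?thesis
      by (simp add: zernike powi_diff_eq_cnj[OF \<open>z \<noteq> 0\<close>] max_absorb2 min_absorb1)
  next
    case False
    then have "N \<le> m" by simp
    define A where "A = fact N * pochhammer (\<kappa> + 1) m / pochhammer (\<kappa> + 1) N"
    define J where "J = jacobi_P N \<kappa> (real m - real N) (2 * (norm z)\<^sup>2 - 1)"
    have abs: "\<bar>real m - of_int n - \<rho>\<bar> = real m - real N"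
      using N \<open>N \<le> m\<close> by simp
    have par: "of_int n - real m + \<rho> = real N - real m"
      using N by simp
    have "zernike L \<kappa> \<rho> m n z = z powi (n - int m) * complex_of_real
        (fact m * jacobi_P m \<kappa> (real N - real m) (2 * (norm z)\<^sup>2 - 1))"
      unfolding zernike par by simp
    also have "\<dots> = z powi (n - int m) * complex_of_real (A * ((norm z)\<^sup>2) ^ (m - N) * J)"
      unfolding jacobi_P_negative_integer_parameter[OF assms(2) \<open>N \<le> m\<close>] A_def J_def ..
    also have "\<dots> = complex_of_real A * (z powi (n - int m) * complex_of_real (norm z ^ (2 * (m - N))))
        * complex_of_real J"
      by (simp only: power_mult of_real_mult of_real_power) (simp only: mult_ac)
    also have "z powi (n - int m) * complex_of_real (norm z ^ (2 * (m - N)))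
        = z powi n * cnj z ^ m / complex_of_real (norm z ^ (2 * N))"
    proof -
      have "norm z ^ (2 * m) = norm z ^ (2 * (m - N)) * norm z ^ (2 * N)"
        unfolding power_add[symmetric] using \<open>N \<le> m\<close> by (intro arg_cong[of _ _ "power (norm z)"]) simp
      then show ?thesis
        using \<open>z \<noteq> 0\<close> by (simp add: powi_diff_eq_cnj)
    qed
    finally show ?thesis
      using \<open>N \<le> m\<close> unfolding abs by (simp add: A_def J_def max_absorb1 min_absorb2 mult_ac)
  qed
  then show "let N = nat (n + int r) in
      zernike L \<kappa> \<rho> m n z =
        complex_of_real (pochhammer (\<kappa> + 1) (max m N) * fact (min m N) / pochhammer (\<kappa> + 1) N)
        * (z powi n * cnj z ^ m / complex_of_real (norm z ^ (2 * min m N)))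
        * complex_of_real
            (jacobi_P (min m N) \<kappa> \<bar>real m - of_int n - \<rho>\<bar> (2 * (norm z)\<^sup>2 - 1))"
    by (simp only: Let_def N_def)
qed

end
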